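(* Let $X$ be a real reflexive Banach space and let $T\colon X\to X^*$ be an operator. Then the equation $Tu=f$ is well-posed for each $f\in X^*$ if and only if $T$ is invertible (bijective) and its inverse $T^{-1}\colon X^*\to X$ is continuous.
   Context: $\langle\cdot,\cdot\rangle$ is the duality pairing between $X^*$ and $X$; $T$ is not assumed linear; continuity is with respect to the norm topologies. For $f\in X^*$, the equation $Tu=f$ ($u\in X$) is equivalent to the variational inequality: $u\in X$, $\langle Tu,v-u\rangle\ge\langle f,v-u\rangle$ for all $v\in X$. A sequence $\{u_n\}\subset X$ is an approximating sequence for $Tu=f$ if there exists $\{\varepsilon_n\}\subset\mathbb{R}$ with $0<\varepsilon_n\to0$ such that for each $n\in\mathbb{N}$, $$\langle Tu_n,v-u_n\rangle\ge\langle f,v-u_n\rangle-\varepsilon_n\|u_n-v\|_X\quad\forall\,v\in X.$$ The equation $Tu=f$ is well-posed if it has a unique solution and every approximating sequence for it converges strongly in $X$ to that solution. *)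

theory Defs
  imports "HOL-Analysis.Analysis"
begin

text \<open>The topological dual of \<open>'a\<close> is the type \<open>'a \<Rightarrow>\<^sub>L real\<close> of bounded linear functionals with the
  operator norm; the duality pairing of \<open>f\<close> and \<open>u\<close> is \<open>blinfun_apply f u\<close>.\<close>

definition canonical_embedding ::
    "'a::real_normed_vector \<Rightarrow> (('a \<Rightarrow>\<^sub>L real) \<Rightarrow>\<^sub>L real)" where
  "canonical_embedding x = Blinfun (\<lambda>f. blinfun_apply f x)"

lemma canonical_embedding_apply [simp]:
  "blinfun_apply (canonical_embedding x) f = blinfun_apply f x"
  unfolding canonical_embedding_def
  by (simp add: bounded_linear_Blinfun_apply blinfun.bounded_linear_left)

definition reflexive_space :: "'a::real_normed_vector itself \<Rightarrow> bool" where
  "reflexive_space _ \<longleftrightarrow>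
     surj (canonical_embedding :: 'a \<Rightarrow> (('a \<Rightarrow>\<^sub>L real) \<Rightarrow>\<^sub>L real))"

definition approximating_sequence ::
    "('a::real_normed_vector \<Rightarrow> ('a \<Rightarrow>\<^sub>L real)) \<Rightarrow> ('a \<Rightarrow>\<^sub>L real) \<Rightarrow> (nat \<Rightarrow> 'a) \<Rightarrow> bool" where
  "approximating_sequence T f u \<longleftrightarrow>
     (\<exists>\<epsilon> :: nat \<Rightarrow> real. (\<forall>n. 0 < \<epsilon> n) \<and> \<epsilon> \<longlonglongrightarrow> 0 \<and>
        (\<forall>n v. blinfun_apply (T (u n)) (v - u n)
                 \<ge> blinfun_apply f (v - u n) - \<epsilon> n * norm (u n - v)))"

definition well_posed ::
    "('a::real_normed_vector \<Rightarrow> ('a \<Rightarrow>\<^sub>L real)) \<Rightarrow> ('a \<Rightarrow>\<^sub>L real) \<Rightarrow> bool" where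
  "well_posed T f \<longleftrightarrow>
     (\<exists>!u. T u = f) \<and>
     (\<forall>u us. T u = f \<longrightarrow> approximating_sequence T f us \<longrightarrow> us \<longlonglongrightarrow> u)"

end

theory Submission
  imports Defs
begin

text \<open>
  The variational inequality with error \<open>\<epsilon>\<close> tests the functional \<open>T u - f\<close> on every vector
  \<open>v - u\<close>. Because \<open>v\<close> ranges over a whole linear space and not just over a convex subset, these
  vectors exhaust the space, and the inequality says exactly that the dual norm of the residual
  \<open>T u - f\<close> is at most \<open>\<epsilon>\<close> (\<open>norm_le_iff_variational_inequality\<close>). Hence approximating sequences
  for \<open>T u = f\<close> are precisely the sequences with \<open>T (us n) \<longlonglongrightarrow> f\<close>
  (\<open>approximating_sequence_iff_tendsto\<close>).

  Unique solvability for every \<open>f\<close> is bijectivity of \<open>T\<close>. Given that, the substitution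
  \<open>g n = T (us n)\<close> turns convergence of all approximating sequences into the implication from
  \<open>g \<longlonglongrightarrow> f\<close> to \<open>inv T (g n) \<longlonglongrightarrow> inv T f\<close>, which is sequential continuity of the inverse
  at \<open>f\<close>.
\<close>

text \<open>A linear functional can be tested on \<open>w\<close> and \<open>- w\<close>, so the one-sided bound on the right already
  controls its absolute value; the vectors \<open>v - x\<close> reach every \<open>w\<close>.\<close>

lemma norm_le_iff_variational_inequality:
  fixes g :: "'a::real_normed_vector \<Rightarrow>\<^sub>L real"
  assumes "0 \<le> e"
  shows "norm g \<le> e \<longleftrightarrow> (\<forall>v. - (e * norm (x - v)) \<le> blinfun_apply g (v - x))"
proof
  assume le: "norm g \<le> e"
  show "\<forall>v. - (e * norm (x - v)) \<le> blinfun_apply g (v - x)"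
  proof
    fix v
    have "\<bar>blinfun_apply g (v - x)\<bar> \<le> norm g * norm (v - x)"
      using norm_blinfun[of g "v - x"] by simp
    also have "\<dots> \<le> e * norm (x - v)"
      using le by (simp add: norm_minus_commute mult_right_mono)
    finally show "- (e * norm (x - v)) \<le> blinfun_apply g (v - x)"
      by linarith
  qed
next
  assume bound: "\<forall>v. - (e * norm (x - v)) \<le> blinfun_apply g (v - x)"
  have "norm (blinfun_apply g w) \<le> e * norm w" for w
    using bound[rule_format, of "x + w"] bound[rule_format, of "x - w"]
    by (simp add: blinfun.minus_right abs_le_iff)
  with assms show "norm g \<le> e"
    by (rule norm_blinfun_bound)
qed

lemma approximating_sequence_iff_tendsto:
  fixes T :: "'a::real_normed_vector \<Rightarrow> ('a \<Rightarrow>\<^sub>L real)"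
  shows "approximating_sequence T f us \<longleftrightarrow> (\<lambda>n. T (us n)) \<longlonglongrightarrow> f"
proof -
  have residual: "(\<forall>v. blinfun_apply (T (us n)) (v - us n)
                 \<ge> blinfun_apply f (v - us n) - e * norm (us n - v)) \<longleftrightarrow> norm (T (us n) - f) \<le> e"
    if "0 < e" for e n
    using that
    by (simp add: norm_le_iff_variational_inequality[where x = "us n"] blinfun.diff_left algebra_simps)
  have "approximating_sequence T f us \<longleftrightarrow>
      (\<exists>\<epsilon> :: nat \<Rightarrow> real. (\<forall>n. 0 < \<epsilon> n) \<and> \<epsilon> \<longlonglongrightarrow> 0 \<and> (\<forall>n. norm (T (us n) - f) \<le> \<epsilon> n))"
    unfolding approximating_sequence_def using residual by metis
  also have "\<dots> \<longleftrightarrow> (\<lambda>n. T (us n)) \<longlonglongrightarrow> f"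
  proof
    assume "\<exists>\<epsilon> :: nat \<Rightarrow> real. (\<forall>n. 0 < \<epsilon> n) \<and> \<epsilon> \<longlonglongrightarrow> 0 \<and> (\<forall>n. norm (T (us n) - f) \<le> \<epsilon> n)"
    then obtain \<epsilon> :: "nat \<Rightarrow> real"
      where "\<epsilon> \<longlonglongrightarrow> 0" and le: "\<And>n. norm (T (us n) - f) \<le> \<epsilon> n"
      by blast
    then have "(\<lambda>n. T (us n) - f) \<longlonglongrightarrow> 0"
      by (intro Lim_null_comparison[of "\<lambda>n. T (us n) - f" \<epsilon>]) auto
    then show "(\<lambda>n. T (us n)) \<longlonglongrightarrow> f"
      by (rule LIM_zero_cancel)
  next
    assume lim: "(\<lambda>n. T (us n)) \<longlonglongrightarrow> f"
    \<comment> \<open>The errors must be strictly positive although the residuals may vanish, hence the added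
      null sequence.\<close>
    define \<epsilon> where "\<epsilon> n = norm (T (us n) - f) + inverse (real (Suc n))" for n
    have "\<epsilon> \<longlonglongrightarrow> 0 + 0"
      unfolding \<epsilon>_def
      using tendsto_norm_zero[OF LIM_zero[OF lim]] LIMSEQ_inverse_real_of_nat
      by (rule tendsto_add)
    moreover have "0 < \<epsilon> n" and "norm (T (us n) - f) \<le> \<epsilon> n" for n
      unfolding \<epsilon>_def by (simp_all add: add_nonneg_pos)
    ultimately show "\<exists>\<epsilon> :: nat \<Rightarrow> real. (\<forall>n. 0 < \<epsilon> n) \<and> \<epsilon> \<longlonglongrightarrow> 0 \<and> (\<forall>n. norm (T (us n) - f) \<le> \<epsilon> n)"
      by auto
  qed
  finally show ?thesis .
qed

theorem theorem13:
  fixes T :: "'a::banach \<Rightarrow> ('a \<Rightarrow>\<^sub>L real)"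
  assumes "reflexive_space TYPE('a)"
  shows "(\<forall>f. well_posed T f) \<longleftrightarrow> bij T \<and> continuous_on UNIV (inv T)"
proof
  assume wp: "\<forall>f. well_posed T f"
  then have "\<forall>f. \<exists>!u. T u = f"
    by (simp add: well_posed_def)
  then have bij: "bij T"
    by (metis bijI injI surjI)
  then have T_inv: "T (inv T f) = f" for f
    by (simp add: bij_is_surj surj_f_inv_f)
  have "continuous_on UNIV (inv T)"
    unfolding continuous_on_sequentially
  proof (intro ballI allI impI)
    fix g :: "nat \<Rightarrow> 'a \<Rightarrow>\<^sub>L real" and f
    assume "(\<forall>n. g n \<in> UNIV) \<and> g \<longlonglongrightarrow> f"
    then have "approximating_sequence T f (inv T \<circ> g)"
      by (simp add: approximating_sequence_iff_tendsto T_inv)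
    with wp T_inv show "(inv T \<circ> g) \<longlonglongrightarrow> inv T f"
      unfolding well_posed_def by blast
  qed
  with bij show "bij T \<and> continuous_on UNIV (inv T)" ..
next
  assume inv: "bij T \<and> continuous_on UNIV (inv T)"
  then have inj: "inj T" and cont: "continuous_on UNIV (inv T)"
    by (simp_all add: bij_is_inj)
  show "\<forall>f. well_posed T f"
    unfolding well_posed_def approximating_sequence_iff_tendsto
  proof (intro allI conjI impI)
    fix f
    show "\<exists>!u. T u = f"
      using inv by (simp add: bij_iff)
  next
    fix f u us
    assume "T u = f" and "(\<lambda>n. T (us n)) \<longlonglongrightarrow> f"
    then have "(\<lambda>n. inv T (T (us n))) \<longlonglongrightarrow> inv T (T u)"
      using continuous_on_tendsto_compose[OF cont, of "\<lambda>n. T (us n)" f] by simp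
    then show "us \<longlonglongrightarrow> u"
      by (simp add: inv_f_f[OF inj])
  qed
qed

end
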